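(* Let $k\ge 2$ be an integer and consider the positions $(a,b)$ in row $k$ of $\mathcal{L}_1$, i.e. pairs of integers with $a+b=k$, $a\ge 1$, $b\ge 0$. Two obstructions cover positions as follows: (1) Difference of squares: applies when $a$ and $b$ are both even. (2) Divisibility by $5$: applies when $a$ and $b$ are both odd with $a\equiv b\pmod 4$. The class of $k$ modulo $4$ determines which positions appear: (a) If $k\equiv 2\pmod 4$: all positions have $a\equiv b\pmod 2$; positions with $a,b$ both even satisfy the difference-of-squares obstruction; positions with $a,b$ both odd satisfy $a\equiv b\pmod 4$. Every position is obstructed. (b) If $k$ is odd: all positions have $a\not\equiv b\pmod 2$, and neither obstruction applies. All $k$ positions are prime-admissible. (c) If $k\equiv 0\pmod 4$: positions with $a,b$ both even satisfy the difference-of-squares obstruction, but positions with $a,b$ both odd have $a\not\equiv b\pmod 4$. Exactly $k/2$ positions are prime-admissible.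
   Context: The principal skeleton is $\mathcal{L}_1=\{2^a\cdot 3^b-1: a\ge 1,\ b\ge 0\}$; position $(a,b)$ holds the element $2^a\cdot 3^b-1$ and lies in row $k=a+b$. The difference-of-squares obstruction applies to (covers) the position $(a,b)$ when $a$ and $b$ are both even, in which case $2^a3^b-1=(2^{a/2}3^{b/2}-1)(2^{a/2}3^{b/2}+1)$. The divisibility-by-$5$ obstruction applies to (covers) the position $(a,b)$ when $a$ and $b$ are both odd and $a\equiv b\pmod 4$, in which case $5\mid 2^a3^b-1$. A position is obstructed if it is covered by at least one of these two obstructions, and prime-admissible if it is covered by neither. *)

theory Defs
  imports "HOL-Number_Theory.Cong"
begin

text \<open>
  Positions are pairs of natural numbers \<open>(a, b)\<close>, the exponents of 2 and 3; the constraint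
  \<open>b \<ge> 0\<close> is built into the type.
\<close>

definition positions :: "(nat \<times> nat) set" where
  "positions = {(a, b). a \<ge> 1}"

fun element :: "nat \<times> nat \<Rightarrow> int" where
  "element (a, b) = 2 ^ a * 3 ^ b - 1"

definition principal_skeleton :: "int set" where
  "principal_skeleton = {2 ^ a * 3 ^ b - 1 | a b :: nat. a \<ge> 1}"

lemma principal_skeleton_eq: "principal_skeleton = element ` positions"
  by (force simp: principal_skeleton_def positions_def)

definition row :: "nat \<Rightarrow> (nat \<times> nat) set" where
  "row k = {(a, b) \<in> positions. a + b = k}"

text \<open>
  The two obstructions are conditions on the exponents; the lemmas following each definition
  give the arithmetic fact about the element that the condition guarantees.
\<close>

fun difference_of_squares :: "nat \<times> nat \<Rightarrow> bool" where
  "difference_of_squares (a, b) \<longleftrightarrow> even a \<and> even b"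

lemma difference_of_squares_factorization:
  assumes "difference_of_squares (a, b)"
  shows "element (a, b) =
    (2 ^ (a div 2) * 3 ^ (b div 2) - 1) * (2 ^ (a div 2) * 3 ^ (b div 2) + 1)"
  using assms by (auto elim!: evenE simp: algebra_simps power_add mult_2_right)

fun divisibility_by_5 :: "nat \<times> nat \<Rightarrow> bool" where
  "divisibility_by_5 (a, b) \<longleftrightarrow> odd a \<and> odd b \<and> [a = b] (mod 4)"

lemma divisibility_by_5_dvd:
  assumes "divisibility_by_5 (a, b)"
  shows "5 dvd element (a, b)"
proof -
  have pow2: "[(2::int) ^ a = 2 ^ (a mod 4)] (mod 5)" for a :: nat
  proof -
    have "[((2::int) ^ 4) ^ (a div 4) = 1 ^ (a div 4)] (mod 5)"
      by (rule cong_pow) (simp add: cong_def)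
    then have "[((2::int) ^ 4) ^ (a div 4) * 2 ^ (a mod 4) = 1 * 2 ^ (a mod 4)] (mod 5)"
      by (intro cong_mult) simp_all
    then show ?thesis
      by (metis mult_1 mult_div_mod_eq power_add power_mult)
  qed
  have "[(2::int) ^ a = 2 ^ b] (mod 5)"
    using assms pow2[of a] pow2[of b] by (simp add: cong_def)
  then have "[(2::int) ^ a * 3 ^ b = 2 ^ b * 3 ^ b] (mod 5)"
    by (intro cong_mult) simp_all
  also have "(2::int) ^ b * 3 ^ b = 6 ^ b"
    by (simp flip: power_mult_distrib)
  also have "[(6::int) ^ b = 1 ^ b] (mod 5)"
    by (rule cong_pow) (simp add: cong_def)
  finally show ?thesis
    by (simp add: cong_iff_dvd_diff)
qed

definition obstructed :: "nat \<times> nat \<Rightarrow> bool" where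
  "obstructed p \<longleftrightarrow> difference_of_squares p \<or> divisibility_by_5 p"

definition prime_admissible :: "nat \<times> nat \<Rightarrow> bool" where
  "prime_admissible p \<longleftrightarrow> \<not> difference_of_squares p \<and> \<not> divisibility_by_5 p"

end

theory Submission
  imports Defs
begin

text \<open>
  The parity of \<open>k = a + b\<close> decides whether \<open>a\<close> and \<open>b\<close> have equal parity, and each
  obstruction requires equal parity; this settles odd \<open>k\<close>. For even \<open>k\<close> the positions with
  both exponents even are differences of squares, so only the odd pairs are in question. If
  \<open>b\<close> is odd then \<open>2 * b\<close> is congruent to 2 modulo 4, hence \<open>a - b = (a + b) - 2 * b\<close> is
  congruent to \<open>k - 2\<close>: the divisibility-by-5 obstruction covers all odd pairs of the row
  when \<open>k\<close> is 2 modulo 4 (lemma \<open>odd_pair_cong_4_iff\<close>) and none of them when \<open>k\<close> is 0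
  modulo 4. In the latter case the prime-admissible positions are exactly those with odd \<open>a\<close>,
  and \<open>{1..k}\<close> contains \<open>k div 2\<close> odd numbers (lemma \<open>card_row_odd\<close>).
\<close>

lemma mem_row_iff: "(a, b) \<in> row k \<longleftrightarrow> a \<ge> 1 \<and> a + b = k"
  by (simp add: row_def positions_def)

lemma row_cong_2_iff:
  assumes "(a, b) \<in> row k"
  shows "[a = b] (mod 2) \<longleftrightarrow> even k"
  using assms unfolding mem_row_iff cong_def by presburger

text \<open>
  For odd \<open>b\<close>, \<open>2 * b\<close> is 2 modulo 4, so adding \<open>b\<close> to both sides of the congruence turns
  it into a condition on \<open>a + b\<close> alone.
\<close>

lemma odd_pair_cong_4_iff:
  fixes a b :: nat
  assumes "odd b"
  shows "[a = b] (mod 4) \<longleftrightarrow> [a + b = 2] (mod 4)"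
proof -
  have "[b + b = 2] (mod 4)"
    using assms unfolding cong_def by presburger
  then have "[a + b = 2] (mod 4) \<longleftrightarrow> [a + b = b + b] (mod 4)"
    by (simp add: cong_def)
  also have "\<dots> \<longleftrightarrow> [a = b] (mod 4)"
    by (rule cong_add_rcancel_nat)
  finally show ?thesis
    by simp
qed

text \<open>
  A position is determined by its row and its first exponent, so counting positions of a row
  amounts to counting first exponents.
\<close>

lemma card_row_filter: "card {(a, b) \<in> row k. P a} = card {a \<in> {1..k}. P a}"
proof -
  have "bij_betw fst {(a, b) \<in> row k. P a} {a \<in> {1..k}. P a}"
    by (rule bij_betw_byWitness[where f' = "\<lambda>a. (a, k - a)"]) (auto simp: mem_row_iff)
  then show ?thesis
    by (rule bij_betw_same_card)
qed

lemma card_row: "card (row k) = k"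
  using card_row_filter[of k "\<lambda>_. True"] by (simp flip: atLeastAtMost_iff)

lemma card_row_odd:
  assumes "even k"
  shows "card {(a, b) \<in> row k. odd a} = k div 2"
proof -
  obtain m where "k = 2 * m"
    using assms by (rule evenE)
  then have "bij_betw (\<lambda>i. 2 * i + 1) {..<k div 2} {a \<in> {1..k}. odd a}"
    by (intro bij_betw_byWitness[where f' = "\<lambda>a. a div 2"]) (auto elim!: oddE)
  then have "card {..<k div 2} = card {a \<in> {1..k}. odd a}"
    by (rule bij_betw_same_card)
  then show ?thesis
    by (simp add: card_row_filter)
qed

lemma row_prime_admissible_iff:
  assumes "(a, b) \<in> row k" and "[k = 0] (mod 4)"
  shows "prime_admissible (a, b) \<longleftrightarrow> odd a"
proof -
  have "a + b = k"
    using assms(1) by (simp add: mem_row_iff)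
  moreover have "even a \<longleftrightarrow> even b"
    using calculation assms(2) unfolding cong_def by presburger
  moreover have "\<not> [k = 2] (mod 4)"
    using assms(2) by (simp add: cong_def)
  ultimately show ?thesis
    using odd_pair_cong_4_iff[of b a] by (auto simp: prime_admissible_def)
qed

theorem theorem4p2:
  fixes k :: nat
  assumes "k \<ge> 2"
  shows
    "([k = 2] (mod 4) \<longrightarrow>
       (\<forall>(a, b) \<in> row k. [a = b] (mod 2)) \<and>
       (\<forall>(a, b) \<in> row k. even a \<and> even b \<longrightarrow> difference_of_squares (a, b)) \<and>
       (\<forall>(a, b) \<in> row k. odd a \<and> odd b \<longrightarrow> [a = b] (mod 4)) \<and>
       (\<forall>p \<in> row k. obstructed p))
     \<and>
     (odd k \<longrightarrow>
       (\<forall>(a, b) \<in> row k. \<not> [a = b] (mod 2)) \<and>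
       (\<forall>p \<in> row k. \<not> difference_of_squares p \<and> \<not> divisibility_by_5 p) \<and>
       card (row k) = k \<and>
       (\<forall>p \<in> row k. prime_admissible p))
     \<and>
     ([k = 0] (mod 4) \<longrightarrow>
       (\<forall>(a, b) \<in> row k. even a \<and> even b \<longrightarrow> difference_of_squares (a, b)) \<and>
       (\<forall>(a, b) \<in> row k. odd a \<and> odd b \<longrightarrow> \<not> [a = b] (mod 4)) \<and>
       card {p \<in> row k. prime_admissible p} = k div 2)"
proof (intro conjI impI)
  assume k: "[k = 2] (mod 4)"
  then have "even k"
    unfolding cong_def by presburger
  then show parity: "\<forall>(a, b) \<in> row k. [a = b] (mod 2)"
    using row_cong_2_iff by blast
  show "\<forall>(a, b) \<in> row k. even a \<and> even b \<longrightarrow> difference_of_squares (a, b)"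
    by auto
  show cong4: "\<forall>(a, b) \<in> row k. odd a \<and> odd b \<longrightarrow> [a = b] (mod 4)"
    using k by (auto simp: mem_row_iff odd_pair_cong_4_iff)
  show "\<forall>p \<in> row k. obstructed p"
  proof clarify
    fix a b assume ab: "(a, b) \<in> row k"
    with parity have "[a = b] (mod 2)"
      by blast
    then have "even a \<longleftrightarrow> even b"
      unfolding cong_def by presburger
    with ab cong4 show "obstructed (a, b)"
      by (auto simp: obstructed_def)
  qed
next
  assume "odd k"
  then show parity: "\<forall>(a, b) \<in> row k. \<not> [a = b] (mod 2)"
    using row_cong_2_iff by blast
  show unobstructed: "\<forall>p \<in> row k. \<not> difference_of_squares p \<and> \<not> divisibility_by_5 p"
    using \<open>odd k\<close> by (auto simp: mem_row_iff)
  show "card (row k) = k"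
    by (rule card_row)
  show "\<forall>p \<in> row k. prime_admissible p"
    using unobstructed by (simp add: prime_admissible_def)
next
  assume k: "[k = 0] (mod 4)"
  then have "even k" and not_2: "\<not> [k = 2] (mod 4)"
    unfolding cong_def by presburger+
  show "\<forall>(a, b) \<in> row k. even a \<and> even b \<longrightarrow> difference_of_squares (a, b)"
    by auto
  show "\<forall>(a, b) \<in> row k. odd a \<and> odd b \<longrightarrow> \<not> [a = b] (mod 4)"
  proof clarify
    fix a b assume "(a, b) \<in> row k" "odd b" "[a = b] (mod 4)"
    with not_2 show False
      using odd_pair_cong_4_iff[of b a] by (simp add: mem_row_iff)
  qed
  have "{p \<in> row k. prime_admissible p} = {(a, b) \<in> row k. odd a}"
    using k by (auto simp: row_prime_admissible_iff)
  then show "card {p \<in> row k. prime_admissible p} = k div 2"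
    using card_row_odd[OF \<open>even k\<close>] by simp
qed

end
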